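(* Let $H\in(0,1)$ and $T>0$. The kernel $S_T$ admits the following representation: (i) For $\omega,\lambda\in\mathbb{R}$ with $\omega\ne\lambda$, $$\frac{S_T(2\omega,2\lambda)}{S_T(0,0)}=(2-2H)\Gamma^2(1-H)\Big(\frac{T^2\omega\lambda}{4}\Big)^He^{iT(\lambda-\omega)}\,\frac{J_{-H}(T\omega)J_{1-H}(T\lambda)-J_{1-H}(T\omega)J_{-H}(T\lambda)}{T(\lambda-\omega)}.$$ (ii) For $\omega\in\mathbb{R}$, $$\frac{S_T(2\omega,2\omega)}{S_T(0,0)}=(2-2H)\Gamma^2(1-H)\Big(\frac{T\omega}{2}\Big)^{2H}\Big(J_{1-H}^2(T\omega)+\frac{2H-1}{T\omega}J_{-H}(T\omega)J_{1-H}(T\omega)+J_{-H}^2(T\omega)\Big).$$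
   Context: $\Gamma$ is Euler's gamma function and $J_\nu$ the Bessel function of the first kind of order $\nu$. $V_t=d_H^2\,t^{2-2H}$ with $d_H^2=\dfrac{\Gamma(3/2-H)}{2H\,\Gamma(H+1/2)\,\Gamma(3-2H)}$. The function $\varphi:\mathbb{R}\to\mathbb{C}$ is $$\varphi(z)=\Gamma(1-H)\Big(\frac z4\Big)^H e^{iz/2}\Big(J_{-H}\Big(\frac z2\Big)+iJ_{1-H}\Big(\frac z2\Big)\Big)\ (z\ne0),\qquad \varphi(0)=1.$$ Here $z^{-\nu}J_\nu(z)$ is always understood as the entire even function $\sum_{k\ge0}\frac{(-1)^k 2^{-\nu}(z/2)^{2k}}{k!\,\Gamma(k+\nu+1)}$, so $z^HJ_{-H}(z)$ and $z^HJ_{1-H}(z)=z\cdot z^{-(1-H)}J_{1-H}(z)$ are entire and $\varphi$ is entire. $S_T(\omega,\lambda)=\int_0^T\overline{\varphi(u\omega)}\varphi(u\lambda)\,dV_u$ for $\omega,\lambda\in\mathbb{R}$. Convention for zero or negative arguments: powers are grouped with the Bessel functions so that only these entire functions occur, e.g. $(T^2\omega\lambda/4)^HJ_{-H}(T\omega)J_{1-H}(T\lambda)=\big[(T\omega/2)^HJ_{-H}(T\omega)\big]\big[(T\lambda/2)^HJ_{1-H}(T\lambda)\big]$, and likewise for $(T\omega/2)^{2H}J_{\nu}(T\omega)J_{\nu'}(T\omega)$ with $\nu,\nu'\in\{-H,1-H\}$; at $\omega=0$ the right-hand side of (ii) is understood as its continuous extension. *)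

theory Defs
  imports "HOL-Analysis.Analysis"
begin

text \<open>
  The entire even function \<open>z\<^sup>-\<^sup>\<nu> J\<^sub>\<nu>(z)\<close>; the quotients with \<open>\<Gamma>(k+\<nu>+1)\<close> are only meant for
  \<open>\<nu>\<close> not a negative integer.
\<close>

definition bessel_entire :: "real \<Rightarrow> complex \<Rightarrow> complex" where
  "bessel_entire \<nu> z =
     (\<Sum>k. (-1) ^ k * of_real (2 powr (-\<nu>)) * (z / 2) ^ (2 * k)
            / (fact k * of_real (Gamma (real k + \<nu> + 1))))"

text \<open>
  The principal branch of \<open>J\<^sub>\<nu>\<close>, for \<open>z \<noteq> 0\<close>.
\<close>

definition Bessel_J :: "real \<Rightarrow> complex \<Rightarrow> complex" where
  "Bessel_J \<nu> z = z powr of_real \<nu> * bessel_entire \<nu> z"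

text \<open>
  \<open>half_pow_J H m z\<close> is \<open>(z/2)\<^sup>H J\<^sub>m\<^sub>-\<^sub>H(z)\<close>, read as an entire function of \<open>z\<close>:
  \<open>(z/2)\<^sup>H J\<^sub>m\<^sub>-\<^sub>H(z) = 2\<^sup>-\<^sup>H z\<^sup>m (z\<^sup>H\<^sup>-\<^sup>m J\<^sub>m\<^sub>-\<^sub>H(z))\<close>. Only \<open>m = 0\<close> (order \<open>-H\<close>) and \<open>m = 1\<close>
  (order \<open>1-H\<close>) are used.
\<close>

definition half_pow_J :: "real \<Rightarrow> nat \<Rightarrow> complex \<Rightarrow> complex" where
  "half_pow_J H m z = of_real (2 powr (-H)) * z ^ m * bessel_entire (real m - H) z"

lemma half_pow_J_eq_Bessel_J:
  assumes "z \<noteq> 0"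
  shows "half_pow_J H m z = (z / 2) powr of_real H * Bessel_J (real m - H) z"
proof -
  have *: "(z / 2) powr of_real H = of_real (2 powr (-H)) * z powr of_real H"
  proof -
    have "Ln (z / 2) = Ln z - of_real (ln 2)"
      using Ln_divide_of_real[of 2 z] assms by simp
    then have "Ln z = Ln (z / 2) + of_real (ln 2)"
      by simp
    then have "exp (of_real H * Ln (z / 2)) = exp (of_real (- H * ln 2) + of_real H * Ln z)"
      by (simp add: algebra_simps)
    then show ?thesis
      using assms by (simp add: powr_def exp_diff exp_minus field_simps flip: exp_of_real)
  qed
  have "z powr of_real H * z powr of_real (real m - H) = z powr of_nat m"
    by (simp flip: powr_add)
  also have "\<dots> = z ^ m"
    using assms by (simp add: powr_nat')
  finally have "z powr of_real H * z powr of_real (real m - H) = z ^ m" .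
  then show ?thesis
    by (simp add: half_pow_J_def Bessel_J_def * mult.assoc flip: mult.assoc[of "z powr of_real H"])
qed

text \<open>
  With \<open>x = z/2\<close> the prefactor \<open>(z/4)\<^sup>H\<close> is \<open>(x/2)\<^sup>H\<close>.  The value at \<open>0\<close> is \<open>1\<close>, as the lemma
  below confirms.
\<close>

definition phi :: "real \<Rightarrow> real \<Rightarrow> complex" where
  "phi H z = of_real (Gamma (1 - H)) * exp (\<i> * of_real (z / 2))
     * (half_pow_J H 0 (of_real (z / 2)) + \<i> * half_pow_J H 1 (of_real (z / 2)))"

lemma phi_0:
  assumes "H < 1"
  shows "phi H 0 = 1"
proof -
  have "bessel_entire (- H) 0 = of_real (2 powr H) / of_real (Gamma (1 - H))"
    unfolding bessel_entire_def
    by (subst suminf_finite[of "{0}"]) (auto simp: power_0_left)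
  moreover have "Gamma (1 - H) \<noteq> 0"
    using assms Gamma_real_pos[of "1 - H"] by linarith
  ultimately show ?thesis
    by (simp add: phi_def half_pow_J_def powr_minus)
qed

definition d_sq :: "real \<Rightarrow> real" where
  "d_sq H = Gamma (3/2 - H) / (2 * H * Gamma (H + 1/2) * Gamma (3 - 2 * H))"

text \<open>
  Extended by \<open>0\<close> to negative times, so that it induces a Lebesgue-Stieltjes measure on the line.
\<close>

definition V :: "real \<Rightarrow> real \<Rightarrow> real" where
  "V H t = d_sq H * (max 0 t) powr (2 - 2 * H)"

definition S :: "real \<Rightarrow> real \<Rightarrow> real \<Rightarrow> real \<Rightarrow> complex" where
  "S H T \<omega> \<mu> =
     set_lebesgue_integral (interval_measure (V H)) {0..T}
       (\<lambda>u. cnj (phi H (u * \<omega>)) * phi H (u * \<mu>))"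

end

theory Submission
  imports Defs
begin

text \<open>
  Write \<open>n = 2 - 2H\<close>, \<open>A(x) = (x/2)\<^sup>H J\<^sub>-\<^sub>H(x)\<close> and \<open>C(x) = (x/2)\<^sup>H J\<^sub>1\<^sub>-\<^sub>H(x) / x\<close>, both entire and even.
  The Bessel recurrences read \<open>A' = -x C\<close> and \<open>x C' = A - n C\<close>.  On \<open>[0, T]\<close> the measure \<open>dV\<^sub>u\<close> has
  density \<open>d\<^sub>H\<^sup>2 n u\<^sup>n\<^sup>-\<^sup>1\<close>, and up to constants the integrand has the primitive
  \<open>u\<^sup>n (\<mu> A(\<omega>u) C(\<mu>u) - \<omega> C(\<omega>u) A(\<mu>u)) exp(i(\<mu> - \<omega>)u) / (\<mu> - \<omega>)\<close> for \<open>\<omega> \<noteq> \<mu>\<close> and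
  \<open>u\<^sup>n (A(\<omega>u)\<^sup>2 + (\<omega>u C(\<omega>u))\<^sup>2 + (2H - 1) A(\<omega>u) C(\<omega>u))\<close> for \<open>\<omega> = \<mu>\<close>.  Both vanish at \<open>0\<close>.  The
  second one covers \<open>\<omega> = 0\<close> as well and is continuous in \<open>\<omega>\<close>, whence \<open>S\<^sub>T(0,0)\<close> and the limit in (ii).
\<close>

section \<open>Power series, derivative and recurrence of the Bessel-Clifford function\<close>

text \<open>
  The Bessel-Clifford function, \<open>x\<^sup>-\<^sup>\<nu> J\<^sub>\<nu>(x) = 2\<^sup>-\<^sup>\<nu> bessel_clifford \<nu> (-x\<^sup>2/4)\<close>.
\<close>

definition bessel_clifford :: "real \<Rightarrow> real \<Rightarrow> real" where
  "bessel_clifford \<nu> y = (\<Sum>k. 1 / (fact k * Gamma (real k + \<nu> + 1)) * y ^ k)"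

lemma Gamma_shift:
  fixes \<nu> :: real
  assumes "\<nu> > -1"
  shows "Gamma (real k + \<nu> + 2) = (real k + \<nu> + 1) * Gamma (real k + \<nu> + 1)"
proof -
  have "real k + \<nu> + 1 > 0"
    using assms by linarith
  then have "real k + \<nu> + 1 \<notin> \<int>\<^sub>\<le>\<^sub>0"
    by (auto elim: nonpos_Ints_cases)
  from Gamma_plus1[OF this] show ?thesis
    by (simp add: add.assoc)
qed

text \<open>Ratio test: by the functional equation of \<open>Gamma\<close>, consecutive terms have
  quotient \<open>y / ((k + 1) * (k + \<nu> + 1))\<close>.\<close>

lemma summable_bessel_clifford:
  fixes \<nu> y :: real
  assumes "\<nu> > -1"
  shows "summable (\<lambda>k. 1 / (fact k * Gamma (real k + \<nu> + 1)) * y ^ k)"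
proof -
  \<comment> \<open>From this index on \<open>k + \<nu> + 1 > 2 * \<bar>y\<bar>\<close>, which
    brings the quotient below 1/2.\<close>
  obtain N :: nat where N: "real N > 2 * \<bar>y\<bar> - \<nu>"
    using reals_Archimedean2 by blast
  show ?thesis
  proof (rule summable_ratio_test[of "1/2" N])
    fix k assume "N \<le> k"
    then have k: "real k + \<nu> + 1 > 2 * \<bar>y\<bar>"
      using N by linarith
    have pos: "real k + \<nu> + 1 > 0" "Gamma (real k + \<nu> + 1) > 0"
      using assms by (auto intro!: Gamma_real_pos)
    define c where "c = 1 / (fact k * Gamma (real k + \<nu> + 1))"
    have "c > 0"
      using pos by (simp add: c_def)
    have "(2 * \<bar>y\<bar>) * 1 \<le> (real k + \<nu> + 1) * (real k + 1)"
      using k pos by (intro mult_mono) auto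
    then have ratio: "\<bar>y\<bar> / ((real k + 1) * (real k + \<nu> + 1)) \<le> 1/2"
      using pos by (subst pos_divide_le_eq) (auto simp: mult.commute)
    have "1 / (fact (Suc k) * Gamma (real (Suc k) + \<nu> + 1)) * y ^ Suc k
        = y / ((real k + 1) * (real k + \<nu> + 1)) * (c * y ^ k)"
      using Gamma_shift[OF assms, of k] by (simp add: c_def add_ac)
    then have "norm (1 / (fact (Suc k) * Gamma (real (Suc k) + \<nu> + 1)) * y ^ Suc k)
        = \<bar>y\<bar> / ((real k + 1) * (real k + \<nu> + 1)) * norm (c * y ^ k)"
      using pos by (simp add: abs_mult)
    also have "\<dots> \<le> 1/2 * norm (c * y ^ k)"
      using ratio by (intro mult_right_mono) auto
    finally show "norm (1 / (fact (Suc k) * Gamma (real (Suc k) + \<nu> + 1)) * y ^ Suc k)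
        \<le> 1/2 * norm (1 / (fact k * Gamma (real k + \<nu> + 1)) * y ^ k)"
      by (simp only: c_def)
  qed simp
qed

text \<open>Differentiating termwise cancels one factor of the factorial and moves the index by one,
  which in the \<open>Gamma\<close> factor amounts to raising \<open>\<nu>\<close> by one.\<close>

lemma has_real_derivative_bessel_clifford:
  assumes "\<nu> > -1"
  shows "(bessel_clifford \<nu> has_real_derivative bessel_clifford (\<nu> + 1) y) (at y)"
proof -
  define c where "c = (\<lambda>k. 1 / (fact k * Gamma (real k + \<nu> + 1)))"
  have "((\<lambda>y. \<Sum>k. c k * y ^ k) has_real_derivative (\<Sum>k. diffs c k * y ^ k)) (at y)"
    by (rule termdiffs_strong_converges_everywhere)
       (use summable_bessel_clifford[OF assms] in \<open>simp add: c_def\<close>)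
  moreover have "diffs c = (\<lambda>k. 1 / (fact k * Gamma (real k + (\<nu> + 1) + 1)))"
  proof
    fix k
    have shift: "real (Suc k) + \<nu> + 1 = real k + (\<nu> + 1) + 1"
      by simp
    then show "diffs c k = 1 / (fact k * Gamma (real k + (\<nu> + 1) + 1))"
      unfolding diffs_def c_def by (simp only: shift fact_Suc) (simp del: of_nat_Suc)
  qed
  moreover have "bessel_clifford \<nu> = (\<lambda>y. \<Sum>k. c k * y ^ k)"
    by (simp add: fun_eq_iff bessel_clifford_def c_def)
  ultimately show ?thesis
    by (simp add: bessel_clifford_def)
qed

text \<open>Comparison of coefficients: \<open>c \<nu> k\<close> is \<open>k + \<nu> + 1\<close>
  times \<open>c (\<nu> + 1) k\<close>. The part \<open>\<nu> + 1\<close> of this factor gives the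
  first summand, the part \<open>k\<close> the series of order \<open>\<nu> + 2\<close> shifted by
  one.\<close>

lemma bessel_clifford_recurrence:
  assumes "\<nu> > -1"
  shows "bessel_clifford \<nu> y
    = (\<nu> + 1) * bessel_clifford (\<nu> + 1) y + y * bessel_clifford (\<nu> + 2) y"
proof -
  define c where "c = (\<lambda>\<nu> k. 1 / (fact k * Gamma (real k + \<nu> + 1)) * y ^ k)"
  have sums: "c \<mu> sums bessel_clifford \<mu> y" if "\<mu> > -1" for \<mu>
    using summable_sums[OF summable_bessel_clifford[OF that, of y]]
    by (simp add: c_def bessel_clifford_def)
  have "(\<lambda>k. y * c (\<nu> + 2) k) sums (y * bessel_clifford (\<nu> + 2) y)"
    using assms by (intro sums_mult sums) auto
  moreover have "y * c (\<nu> + 2) k = real (Suc k) * c (\<nu> + 1) (Suc k)" for k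
  proof -
    have shift: "real (Suc k) + (\<nu> + 1) + 1 = real k + (\<nu> + 2) + 1"
      by simp
    then show ?thesis
      unfolding c_def by (simp only: shift fact_Suc) (simp del: of_nat_Suc)
  qed
  \<comment> \<open>The shift back to index 0 adds nothing, since the term at \<open>k = 0\<close>
    is zero.\<close>
  ultimately have "(\<lambda>k. real k * c (\<nu> + 1) k) sums (y * bessel_clifford (\<nu> + 2) y)"
    using sums_Suc_iff[of "\<lambda>k. real k * c (\<nu> + 1) k"] by simp
  then have "(\<lambda>k. (\<nu> + 1) * c (\<nu> + 1) k + real k * c (\<nu> + 1) k)
      sums ((\<nu> + 1) * bessel_clifford (\<nu> + 1) y + y * bessel_clifford (\<nu> + 2) y)"
    using assms by (intro sums_add sums_mult sums) auto
  moreover have "(\<nu> + 1) * c (\<nu> + 1) k + real k * c (\<nu> + 1) k = c \<nu> k" for k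
  proof -
    have pos: "real k + \<nu> + 1 > 0" "Gamma (real k + \<nu> + 1) > 0"
      using assms by (auto intro!: Gamma_real_pos)
    have "(\<nu> + 1) * c (\<nu> + 1) k + real k * c (\<nu> + 1) k = (real k + \<nu> + 1) * c (\<nu> + 1) k"
      by (simp add: algebra_simps)
    also have "\<dots> = c \<nu> k"
      using Gamma_shift[OF assms, of k] pos by (simp add: c_def add_ac)
    finally show ?thesis .
  qed
  ultimately show ?thesis
    using sums_unique2[OF sums[OF assms]] by simp
qed

lemma bessel_clifford_0: "bessel_clifford \<nu> 0 = 1 / Gamma (\<nu> + 1)"
  unfolding bessel_clifford_def by (subst suminf_finite[of "{0}"]) (auto simp: power_0_left)

text \<open>On the real line every coefficient is real, so the Bessel calculus below can be done
  with real derivatives.\<close>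

lemma bessel_entire_eq_bessel_clifford:
  assumes "\<nu> > -1"
  shows "bessel_entire \<nu> (of_real x) = of_real (2 powr (-\<nu>) * bessel_clifford \<nu> (- (x\<^sup>2 / 4)))"
proof -
  have *: "(-1) ^ k * of_real (2 powr (-\<nu>)) * (of_real x / 2) ^ (2 * k)
      / (fact k * of_real (Gamma (real k + \<nu> + 1)))
    = (of_real (2 powr (-\<nu>) * (1 / (fact k * Gamma (real k + \<nu> + 1)) * (- (x\<^sup>2 / 4)) ^ k)) :: complex)"
    for k
  proof -
    have "(- (x\<^sup>2 / 4)) ^ k = (-1) ^ k * (x / 2) ^ (2 * k)"
      by (simp add: power_mult power_divide power_minus[of "x\<^sup>2 / 4"])
    then show ?thesis
      by simp
  qed
  have "bessel_entire \<nu> (of_real x)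
      = (\<Sum>k. of_real (2 powr (-\<nu>) * (1 / (fact k * Gamma (real k + \<nu> + 1)) * (- (x\<^sup>2 / 4)) ^ k)))"
    unfolding bessel_entire_def * by (rule refl)
  also have "\<dots> = of_real (\<Sum>k. 2 powr (-\<nu>) * (1 / (fact k * Gamma (real k + \<nu> + 1)) * (- (x\<^sup>2 / 4)) ^ k))"
    by (intro suminf_of_real[symmetric] summable_mult summable_bessel_clifford assms)
  also have "(\<Sum>k. 2 powr (-\<nu>) * (1 / (fact k * Gamma (real k + \<nu> + 1)) * (- (x\<^sup>2 / 4)) ^ k))
      = 2 powr (-\<nu>) * bessel_clifford \<nu> (- (x\<^sup>2 / 4))"
    unfolding bessel_clifford_def by (intro suminf_mult summable_bessel_clifford assms)
  finally show ?thesis .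
qed

section \<open>The real functions A and C and their differential equations\<close>

text \<open>This is A of the overview; the powers of 2 in \<open>half_pow_J H 0\<close>
  cancel.\<close>

definition half_pow_even :: "real \<Rightarrow> real \<Rightarrow> real" where
  "half_pow_even H x = bessel_clifford (-H) (- (x\<^sup>2 / 4))"

text \<open>This is C of the overview. The factor 1/2 is
  \<open>2 powr (-H) * 2 powr (-(1 - H))\<close>, and the zero of \<open>half_pow_J H 1\<close> at 0
  is divided out, so that the function has a value there.\<close>

definition half_pow_odd_quot :: "real \<Rightarrow> real \<Rightarrow> real" where
  "half_pow_odd_quot H x = bessel_clifford (1 - H) (- (x\<^sup>2 / 4)) / 2"

context
  fixes H :: real
  assumes H: "0 < H" "H < 1"
begin

lemma half_pow_J_0: "half_pow_J H 0 (of_real x) = of_real (half_pow_even H x)"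
  using H by (simp add: half_pow_J_def half_pow_even_def bessel_entire_eq_bessel_clifford
      powr_minus flip: of_real_mult of_real_inverse)

lemma half_pow_J_1: "half_pow_J H 1 (of_real x) = of_real (x * half_pow_odd_quot H x)"
proof -
  have "2 powr (-H) * 2 powr (-(1 - H)) = (2 powr (-1) :: real)"
    by (subst powr_add[symmetric]) simp
  then have half: "2 powr (-H) * 2 powr (-(1 - H)) = (1/2 :: real)"
    by (simp only: powr_minus_divide powr_one)
  have *: "2 powr (-H) * (x * (2 powr (-(1 - H)) * y)) = x * (y / 2)" for y :: real
  proof -
    have "2 powr (-H) * (x * (2 powr (-(1 - H)) * y)) = (2 powr (-H) * 2 powr (-(1 - H))) * (x * y)"
      by (simp only: mult_ac)
    then show ?thesis
      unfolding half by simp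
  qed
  have "half_pow_J H 1 (of_real x)
      = of_real (2 powr (-H) * (x * (2 powr (-(1 - H)) * bessel_clifford (1 - H) (- (x\<^sup>2 / 4)))))"
    using H by (simp add: half_pow_J_def bessel_entire_eq_bessel_clifford mult.assoc)
  then show ?thesis
    by (simp only: * half_pow_odd_quot_def)
qed

lemma half_pow_even_0: "half_pow_even H 0 = 1 / Gamma (1 - H)"
  by (simp add: half_pow_even_def bessel_clifford_0)

text \<open>This is the relation x C' = A - n C at x = 0, obtained here from
  \<open>Gamma (2 - H) = (1 - H) * Gamma (1 - H)\<close>. It normalises
  \<open>S H T 0 0\<close>.\<close>

lemma half_pow_odd_quot_0: "(2 - 2 * H) * half_pow_odd_quot H 0 = half_pow_even H 0"
proof -
  have "Gamma (1 - H + 1) = (1 - H) * Gamma (1 - H)"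
    using Gamma_shift[of "-H" 0] H by (simp add: algebra_simps)
  then have "half_pow_odd_quot H 0 = 1 / ((1 - H) * Gamma (1 - H)) / 2"
    by (simp only: half_pow_odd_quot_def bessel_clifford_0 power2_eq_square mult_zero_left
        div_0 minus_zero)
  then have "(2 - 2 * H) * half_pow_odd_quot H 0 = (2 * (1 - H)) * (1 / ((1 - H) * Gamma (1 - H)) / 2)"
    by (simp only: right_diff_distrib mult_1_right)
  then show ?thesis
    using H by (simp only: half_pow_even_0) (simp add: divide_simps)
qed

lemma has_real_derivative_half_pow_even:
  "((\<lambda>u. half_pow_even H (c * u)) has_real_derivative - (c\<^sup>2 * u * half_pow_odd_quot H (c * u))) (at u)"
proof -
  have "((\<lambda>u. - ((c * u)\<^sup>2 / 4)) has_real_derivative - (c\<^sup>2 * u / 2)) (at u)"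
    by (auto intro!: derivative_eq_intros simp: power2_eq_square)
  from DERIV_chain2[OF has_real_derivative_bessel_clifford[of "-H"] this] H show ?thesis
    by (simp add: half_pow_even_def half_pow_odd_quot_def mult_ac)
qed

text \<open>The chain rule produces the function of order \<open>2 - H\<close>; the recurrence at
  \<open>\<nu> = -H\<close> expresses it through A and C, at the price of a division by
  \<open>u\<close>.\<close>

lemma has_real_derivative_half_pow_odd_quot:
  assumes "u \<noteq> 0"
  shows "((\<lambda>u. half_pow_odd_quot H (c * u)) has_real_derivative
    (half_pow_even H (c * u) - (2 - 2 * H) * half_pow_odd_quot H (c * u)) / u) (at u)"
proof -
  let ?y = "- ((c * u)\<^sup>2 / 4)"
  have "((\<lambda>u. - ((c * u)\<^sup>2 / 4)) has_real_derivative - (c\<^sup>2 * u / 2)) (at u)"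
    by (auto intro!: derivative_eq_intros simp: power2_eq_square)
  from DERIV_cdivide[OF DERIV_chain2[OF has_real_derivative_bessel_clifford[of "1 - H"] this], of 2] H
  have "((\<lambda>u. half_pow_odd_quot H (c * u)) has_real_derivative
      bessel_clifford (2 - H) ?y * (- (c\<^sup>2 * u) / 4)) (at u)"
    by (simp add: half_pow_odd_quot_def)
  moreover have "half_pow_even H (c * u) - (2 - 2 * H) * half_pow_odd_quot H (c * u)
      = ?y * bessel_clifford (2 - H) ?y"
    using bessel_clifford_recurrence[of "-H" ?y] H
    by (simp add: half_pow_even_def half_pow_odd_quot_def algebra_simps)
  moreover have "?y * B / u = B * (- (c\<^sup>2 * u) / 4)" for B
    using assms by (simp add: power2_eq_square)
  ultimately show ?thesis
    by (simp only:)
qed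

lemma continuous_on_half_pow:
  "continuous_on X (\<lambda>u. half_pow_even H (c * u))"
  "continuous_on X (\<lambda>u. half_pow_odd_quot H (c * u))"
proof -
  have cont: "continuous_on X (\<lambda>u. bessel_clifford \<nu> (- ((c * u)\<^sup>2 / 4)))" if "\<nu> > -1" for \<nu>
  proof (rule continuous_on_compose2[of UNIV "bessel_clifford \<nu>"])
    show "continuous_on UNIV (bessel_clifford \<nu>)"
      using that by (intro continuous_at_imp_continuous_on ballI)
        (rule DERIV_isCont[OF has_real_derivative_bessel_clifford])
    show "continuous_on X (\<lambda>u. - ((c * u)\<^sup>2 / 4))"
      by (intro continuous_intros) simp
  qed simp
  show "continuous_on X (\<lambda>u. half_pow_even H (c * u))"
    "continuous_on X (\<lambda>u. half_pow_odd_quot H (c * u))"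
    unfolding half_pow_even_def half_pow_odd_quot_def
    using H by (auto intro!: continuous_on_divide cont continuous_on_const)
qed

end

section \<open>Stieltjes measures with a density and the fundamental theorem for them\<close>

text \<open>Both measures give \<open>F b - F a\<close> to each half-open interval. These intervals
  form an intersection-stable generator of the Borel sets, and countably many of finite measure
  cover the line.\<close>

lemma interval_measure_eq_density:
  fixes F f :: "real \<Rightarrow> real"
  assumes [measurable]: "f \<in> borel_measurable borel"
    and nonneg: "\<And>x. 0 \<le> f x"
    and int: "\<And>a b. a \<le> b \<Longrightarrow> (f has_integral F b - F a) {a..b}"
    and cont: "continuous_on UNIV F"
  shows "interval_measure F = density lborel f"
proof (rule measure_eqI_generator_eq)
  let ?E = "range (\<lambda>(a, b). {a<..b::real})"
  have mono: "F a \<le> F b" if "a \<le> b" for a b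
    using has_integral_nonneg[OF int[OF that]] nonneg by simp
  have right: "continuous (at_right a) F" for a
    using cont by (simp add: continuous_on_eq_continuous_at continuous_at_imp_continuous_at_within)
  have Ioc: "emeasure (interval_measure F) {a<..b} = ennreal (F b - F a)" if "a \<le> b" for a b
    using that mono right by (intro emeasure_interval_measure_Ioc) auto
  show "Int_stable ?E"
  proof (rule Int_stableI)
    fix X Y assume "X \<in> ?E" "Y \<in> ?E"
    then obtain a b c d where "X = {a<..b}" "Y = {c<..d}"
      by auto
    \<comment> \<open>Disjoint intervals are covered too: the right-hand side is then an interval
      with reversed ends, hence empty.\<close>
    then have "X \<inter> Y = (\<lambda>(a, b). {a<..b}) (max a c, min b d)"
      by auto
    then show "X \<inter> Y \<in> ?E"
      by blast
  qed
  show "sets (interval_measure F) = sigma_sets UNIV ?E" "sets (density lborel f) = sigma_sets UNIV ?E"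
    by (simp_all add: borel_sigma_sets_Ioc)
  show "emeasure (interval_measure F) X = emeasure (density lborel f) X" if "X \<in> ?E" for X
  proof -
    from that obtain a b where X: "X = {a<..b}"
      by auto
    show ?thesis
    proof (cases "a \<le> b")
      case True
      have "emeasure (density lborel f) X = (\<integral>\<^sup>+x. ennreal (f x) * indicator {a<..b} x \<partial>lborel)"
        by (simp add: X emeasure_density)
      \<comment> \<open>The integral hypothesis speaks of closed intervals; the added left endpoint
        is a null set.\<close>
      also have "\<dots> = (\<integral>\<^sup>+x. ennreal (f x) * indicator {a..b} x \<partial>lborel)"
        by (intro nn_integral_cong_AE eventually_mono[OF AE_lborel_singleton[of a]])
           (auto simp: indicator_def)
      also have "\<dots> = ennreal (F b - F a)"
        using nonneg int[OF True] by (intro nn_integral_has_integral_lebesgue')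
      finally show ?thesis
        using Ioc[OF True] by (simp add: X)
    qed (simp add: X)
  qed
  show "range (\<lambda>i. {- real i<..real i}) \<subseteq> ?E"
    by auto
  show "(\<Union>i. {- real i<..real i}) = UNIV"
  proof (intro set_eqI iffI UNIV_I)
    fix x :: real
    obtain i :: nat where "real i > \<bar>x\<bar>"
      using reals_Archimedean2 by blast
    then show "x \<in> (\<Union>i. {- real i<..real i})"
      by (intro UN_I[of i]) auto
  qed
  show "emeasure (interval_measure F) {- real i<..real i} \<noteq> \<infinity>" for i
    by (simp add: Ioc)
qed simp

text \<open>Passing to the density turns the left side into the integral of
  \<open>f u *\<^sub>R g u\<close>, which exists because \<open>f\<close> is integrable and
  \<open>g\<close> bounded. Derivatives are asked for only in the open interval, so \<open>f\<close>
  may blow up at an endpoint, as the density of \<open>V H\<close> does at 0 for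
  \<open>H > 1/2\<close>.\<close>

lemma set_integral_interval_measure_FTC:
  fixes F f :: "real \<Rightarrow> real" and g P :: "real \<Rightarrow> 'a::euclidean_space"
  assumes meas[measurable]: "f \<in> borel_measurable borel"
    and nonneg: "\<And>x. 0 \<le> f x"
    and int: "\<And>a b. a \<le> b \<Longrightarrow> (f has_integral F b - F a) {a..b}"
    and cont: "continuous_on UNIV F"
    and "a \<le> b"
    and g: "continuous_on {a..b} g"
    and P: "continuous_on {a..b} P"
    and deriv: "\<And>u. u \<in> {a<..<b} \<Longrightarrow> (P has_vector_derivative f u *\<^sub>R g u) (at u)"
  shows "set_lebesgue_integral (interval_measure F) {a..b} g = P b - P a"
proof -
  have g_meas[measurable]: "(\<lambda>u. indicator {a..b} u *\<^sub>R g u) \<in> borel_measurable borel"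
    using g by (intro borel_measurable_continuous_on_indicator) auto
  have fg_meas: "set_borel_measurable lborel {a..b} (\<lambda>u. f u *\<^sub>R g u)"
  proof -
    have "(\<lambda>u. f u *\<^sub>R (indicator {a..b} u *\<^sub>R g u)) \<in> borel_measurable borel"
      by measurable
    then show ?thesis
      by (simp add: set_borel_measurable_def mult.commute)
  qed
  obtain M where M: "\<And>u. u \<in> {a..b} \<Longrightarrow> norm (g u) \<le> M"
    using compact_imp_bounded[OF compact_continuous_image[OF g compact_Icc]]
    unfolding bounded_iff by blast
  have "f absolutely_integrable_on {a..b}"
    using int[OF \<open>a \<le> b\<close>] nonneg by (intro nonnegative_absolutely_integrable_1) (auto simp: integrable_on_def)
  then have "set_integrable lborel {a..b} f"
    by (simp add: set_integrable_def integrable_completion)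
  then have "set_integrable lborel {a..b} (\<lambda>u. M * f u)"
    by (rule set_integrable_mult_right)
  then have *: "set_integrable lborel {a..b} (\<lambda>u. f u *\<^sub>R g u)"
  proof (rule set_integrable_bound[OF _ fg_meas])
    show "AE u in lborel. u \<in> {a..b} \<longrightarrow> norm (f u *\<^sub>R g u) \<le> norm (M * f u)"
    proof (intro AE_I2 impI)
      fix u assume "u \<in> {a..b}"
      then have "norm (f u *\<^sub>R g u) \<le> f u * M"
        using M nonneg by (simp add: mult_left_mono)
      also have "\<dots> \<le> norm (M * f u)"
        by (simp add: mult.commute)
      finally show "norm (f u *\<^sub>R g u) \<le> norm (M * f u)" .
    qed
  qed
  have "set_lebesgue_integral (interval_measure F) {a..b} g
      = integral\<^sup>L (density lborel f) (\<lambda>u. indicator {a..b} u *\<^sub>R g u)"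
    by (simp add: set_lebesgue_integral_def interval_measure_eq_density[OF meas nonneg int cont])
  also have "\<dots> = (LINT u:{a..b}|lborel. f u *\<^sub>R g u)"
    using nonneg by (subst integral_density) (auto simp: set_lebesgue_integral_def mult.commute)
  also have "\<dots> = integral {a..b} (\<lambda>u. f u *\<^sub>R g u)"
    by (rule set_borel_integral_eq_integral(2)[OF *])
  also have "\<dots> = P b - P a"
    by (intro integral_unique fundamental_theorem_of_calculus_interior \<open>a \<le> b\<close> P deriv)
  finally show ?thesis .
qed

section \<open>The density of \<open>V H\<close>\<close>

lemma d_sq_pos:
  assumes "0 < H" "H < 1"
  shows "d_sq H > 0"
  using assms unfolding d_sq_def by (intro divide_pos_pos mult_pos_pos Gamma_real_pos) auto

lemma continuous_on_V:
  assumes "H < 1"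
  shows "continuous_on X (V H)"
  unfolding V_def using assms by (intro continuous_intros continuous_on_powr') auto

text \<open>Since \<open>0 powr x = 0\<close> for every exponent, the density is 0 at all
  \<open>u \<le> 0\<close>, matching the constant \<open>V H\<close> there.\<close>

definition V_density :: "real \<Rightarrow> real \<Rightarrow> real" where
  "V_density H u = d_sq H * (2 - 2 * H) * max 0 u powr (1 - 2 * H)"

text \<open>For \<open>H \<ge> 1/2\<close> the function \<open>V H\<close> can fail to be
  differentiable at 0, but it is continuous there; the fundamental theorem tolerates this one
  exceptional point.\<close>

lemma has_integral_V_density:
  assumes "H < 1" "a \<le> b"
  shows "(V_density H has_integral V H b - V H a) {a..b}"
proof (rule fundamental_theorem_of_calculus_interior_strong[of "{0}"])
  show "(V H has_vector_derivative V_density H u) (at u)" if "u \<in> {a<..<b} - {0}" for u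
  proof (cases "u > 0")
    case True
    have "((\<lambda>t. d_sq H * t powr (2 - 2 * H)) has_real_derivative V_density H u) (at u)"
      using True by (auto intro!: derivative_eq_intros simp: V_density_def algebra_simps)
    then have "(V H has_real_derivative V_density H u) (at u)"
      by (rule has_field_derivative_transform_within_open[of _ _ _ "{0<..}"])
         (use True in \<open>auto simp: V_def\<close>)
    then show ?thesis
      by (simp add: has_real_derivative_iff_has_vector_derivative)
  next
    case False
    then have "u < 0"
      using that by auto
    have "((\<lambda>_. 0) has_real_derivative V_density H u) (at u)"
      using \<open>u < 0\<close> by (simp add: V_density_def)
    then have "(V H has_real_derivative V_density H u) (at u)"
      by (rule has_field_derivative_transform_within_open[of _ _ _ "{..<0}"])
         (use \<open>u < 0\<close> in \<open>auto simp: V_def\<close>)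
    then show ?thesis
      by (simp add: has_real_derivative_iff_has_vector_derivative)
  qed
qed (use assms in \<open>auto intro: continuous_on_V\<close>)

section \<open>Closed forms of the kernel via explicit primitives\<close>

context
  fixes H :: real
  assumes H: "0 < H" "H < 1"
begin

lemma phi_double:
  "phi H (2 * x) = of_real (Gamma (1 - H)) * exp (\<i> * of_real x)
     * (of_real (half_pow_even H x) + \<i> * of_real (x * half_pow_odd_quot H x))"
proof -
  have "2 * x / 2 = x"
    by simp
  then show ?thesis
    unfolding phi_def by (simp only: half_pow_J_0[OF H] half_pow_J_1[OF H])
qed

text \<open>A and C are real, so conjugation only flips the sign of \<open>\<i>\<close>. Multiplying
  out separates the bracket into the real and imaginary parts that the primitives have to
  match.\<close>

lemma cnj_phi_mult_phi:
  fixes u \<omega> \<mu> :: real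
  defines "A\<^sub>1 \<equiv> half_pow_even H (\<omega> * u)" and "A\<^sub>2 \<equiv> half_pow_even H (\<mu> * u)"
    and "C\<^sub>1 \<equiv> half_pow_odd_quot H (\<omega> * u)" and "C\<^sub>2 \<equiv> half_pow_odd_quot H (\<mu> * u)"
  shows "cnj (phi H (u * (2 * \<omega>))) * phi H (u * (2 * \<mu>))
    = of_real ((Gamma (1 - H))\<^sup>2) * exp (\<i> * of_real ((\<mu> - \<omega>) * u))
      * (of_real (A\<^sub>1 * A\<^sub>2 + \<omega> * \<mu> * u\<^sup>2 * C\<^sub>1 * C\<^sub>2)
         + \<i> * of_real (u * (\<mu> * A\<^sub>1 * C\<^sub>2 - \<omega> * C\<^sub>1 * A\<^sub>2)))"
proof -
  have eq: "u * (2 * x) = 2 * (x * u)" for x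
    by simp
  have exp: "exp (\<i> * of_real ((\<mu> - \<omega>) * u)) = exp (\<i> * of_real (\<mu> * u)) * exp (- (\<i> * of_real (\<omega> * u)))"
    by (simp add: algebra_simps flip: exp_add)
  have "cnj (exp (\<i> * of_real (\<omega> * u))) = exp (- (\<i> * of_real (\<omega> * u)))"
    by (simp add: exp_cnj)
  then have "cnj (phi H (u * (2 * \<omega>))) = of_real (Gamma (1 - H)) * exp (- (\<i> * of_real (\<omega> * u)))
     * (of_real A\<^sub>1 - \<i> * of_real (\<omega> * u * C\<^sub>1))"
    unfolding eq phi_double A\<^sub>1_def C\<^sub>1_def by simp
  moreover have "phi H (u * (2 * \<mu>)) = of_real (Gamma (1 - H)) * exp (\<i> * of_real (\<mu> * u))
     * (of_real A\<^sub>2 + \<i> * of_real (\<mu> * u * C\<^sub>2))"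
    unfolding eq phi_double A\<^sub>2_def C\<^sub>2_def by simp
  moreover have "(of_real A\<^sub>1 - \<i> * of_real (\<omega> * u * C\<^sub>1)) * (of_real A\<^sub>2 + \<i> * of_real (\<mu> * u * C\<^sub>2))
      = (of_real (A\<^sub>1 * A\<^sub>2 + \<omega> * \<mu> * u\<^sup>2 * C\<^sub>1 * C\<^sub>2)
         + \<i> * of_real (u * (\<mu> * A\<^sub>1 * C\<^sub>2 - \<omega> * C\<^sub>1 * A\<^sub>2)))"
    by (simp add: complex_eq_iff algebra_simps power2_eq_square)
  ultimately show ?thesis
    unfolding exp of_real_power by (simp only: power2_eq_square mult_ac)
qed

lemma S_eq_primitive:
  fixes P :: "real \<Rightarrow> complex"
  assumes "0 \<le> T"
    and P: "continuous_on {0..T} P"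
    and deriv: "\<And>u. u \<in> {0<..<T} \<Longrightarrow>
      (P has_vector_derivative V_density H u *\<^sub>R (cnj (phi H (u * (2 * \<omega>))) * phi H (u * (2 * \<mu>)))) (at u)"
  shows "S H T (2 * \<omega>) (2 * \<mu>) = P T - P 0"
  unfolding S_def
proof (rule set_integral_interval_measure_FTC[of "V_density H"])
  show "V_density H \<in> borel_measurable borel"
    unfolding V_density_def by measurable
  show "0 \<le> V_density H u" for u
    using H d_sq_pos[OF H] by (simp add: V_density_def)
  show "continuous_on {0..T} (\<lambda>u. cnj (phi H (u * (2 * \<omega>))) * phi H (u * (2 * \<mu>)))"
    unfolding cnj_phi_mult_phi by (intro continuous_intros continuous_on_half_pow H)
qed (use assms H in \<open>auto intro: has_integral_V_density continuous_on_V\<close>)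

text \<open>The differential equations give \<open>u * K' = (\<mu> - \<omega>) * L - n * K\<close>,
  hence u^n K has derivative \<open>(\<mu> - \<omega>)\<close> times u^(n-1) L. Differentiating the
  exponential adds \<open>\<i> * (\<mu> - \<omega>)\<close> times u^n K, and the sum is
  \<open>(\<mu> - \<omega>)\<close> times the integrand, up to the constant
  \<open>k\<close>.\<close>

lemma S_off_diagonal:
  assumes "0 \<le> T" "\<omega> \<noteq> \<mu>"
  shows "S H T (2 * \<omega>) (2 * \<mu>)
    = of_real (d_sq H * (2 - 2 * H) * (Gamma (1 - H))\<^sup>2 * T powr (2 - 2 * H)
        * (\<mu> * half_pow_even H (\<omega> * T) * half_pow_odd_quot H (\<mu> * T)
           - \<omega> * half_pow_odd_quot H (\<omega> * T) * half_pow_even H (\<mu> * T)) / (\<mu> - \<omega>))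
      * exp (\<i> * of_real ((\<mu> - \<omega>) * T))"
proof -
  define k where "k = d_sq H * (2 - 2 * H) * (Gamma (1 - H))\<^sup>2"
  define A where "A = half_pow_even H"
  define C where "C = half_pow_odd_quot H"
  define K where "K = (\<lambda>u. \<mu> * A (\<omega> * u) * C (\<mu> * u) - \<omega> * C (\<omega> * u) * A (\<mu> * u))"
  define L where "L = (\<lambda>u. A (\<omega> * u) * A (\<mu> * u) + \<omega> * \<mu> * u\<^sup>2 * C (\<omega> * u) * C (\<mu> * u))"
  define Q where "Q = (\<lambda>u. u powr (2 - 2 * H) * K u)"
  define e where "e = (\<lambda>u. exp (\<i> * of_real ((\<mu> - \<omega>) * u)))"
  define P where "P = (\<lambda>u. of_real (k * Q u / (\<mu> - \<omega>)) * e u)"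
  have dK: "(K has_real_derivative ((\<mu> - \<omega>) * L u - (2 - 2 * H) * K u) / u) (at u)" if "u > 0" for u
    unfolding K_def L_def A_def C_def
    by (rule has_real_derivative_half_pow_even[OF H]
          has_real_derivative_half_pow_odd_quot[OF H less_imp_neq[OF that, symmetric]]
          derivative_eq_intros refl)+
       (use that in \<open>simp add: field_simps power2_eq_square\<close>)
  have dQ: "(Q has_real_derivative (\<mu> - \<omega>) * u powr (1 - 2 * H) * L u) (at u)" if "u > 0" for u
  proof -
    have "(Q has_real_derivative (2 - 2 * H) * u powr (1 - 2 * H) * K u
        + ((\<mu> - \<omega>) * L u - (2 - 2 * H) * K u) / u * u powr (2 - 2 * H)) (at u)"
      unfolding Q_def using that by (auto intro!: derivative_eq_intros dK)
    moreover have "M / u * u powr (2 - 2 * H) = M * u powr (1 - 2 * H)" for M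
      using that by (simp add: powr_diff power2_eq_square)
    ultimately show ?thesis
      by (simp only:) (simp add: algebra_simps)
  qed
  have de: "(e has_vector_derivative \<i> * of_real (\<mu> - \<omega>) * e u) (at u)" for u
  proof -
    \<comment> \<open>The complex derivative is taken first and then restricted to the real
      line.\<close>
    have "((\<lambda>z. exp (\<i> * of_real (\<mu> - \<omega>) * z)) has_field_derivative
        \<i> * of_real (\<mu> - \<omega>) * exp (\<i> * of_real (\<mu> - \<omega>) * of_real u)) (at (of_real u))"
      by (auto intro!: derivative_eq_intros)
    then show ?thesis
      unfolding e_def of_real_mult mult.assoc[symmetric] by (rule has_vector_derivative_real_field)
  qed
  have "S H T (2 * \<omega>) (2 * \<mu>) = P T - P 0"
  proof (rule S_eq_primitive[OF \<open>0 \<le> T\<close>])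
    show "continuous_on {0..T} P"
      unfolding P_def Q_def K_def e_def A_def C_def using H \<open>\<omega> \<noteq> \<mu>\<close>
      by (intro continuous_intros continuous_on_half_pow continuous_on_powr') auto
    fix u assume "u \<in> {0<..<T}"
    then have u: "u > 0"
      by simp
    \<comment> \<open>One factor \<open>u\<close> leaves the power, leaving the density and turning
      \<open>K u\<close> into the imaginary part \<open>u * K u\<close>.\<close>
    have uu: "u powr (2 - 2 * H) = u * u powr (1 - 2 * H)"
      using u by (simp add: powr_mult_base)
    have "(P has_vector_derivative of_real (k * Q u / (\<mu> - \<omega>)) * (\<i> * of_real (\<mu> - \<omega>) * e u)
        + of_real (k * ((\<mu> - \<omega>) * u powr (1 - 2 * H) * L u) / (\<mu> - \<omega>)) * e u) (at u)"
      unfolding P_def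
      by (intro has_vector_derivative_mult has_vector_derivative_of_real de
            DERIV_cmult DERIV_cdivide dQ u
            has_real_derivative_iff_has_vector_derivative[THEN iffD1])
    also have "of_real (k * Q u / (\<mu> - \<omega>)) * (\<i> * of_real (\<mu> - \<omega>) * e u)
        + of_real (k * ((\<mu> - \<omega>) * u powr (1 - 2 * H) * L u) / (\<mu> - \<omega>)) * e u
        = \<i> * of_real (k * Q u / (\<mu> - \<omega>) * (\<mu> - \<omega>)) * e u
          + of_real (k * ((\<mu> - \<omega>) * u powr (1 - 2 * H) * L u) / (\<mu> - \<omega>)) * e u"
      by (simp only: of_real_mult mult_ac)
    also have "\<dots> = of_real (k * u powr (1 - 2 * H)) * e u * (of_real (L u) + \<i> * of_real (u * K u))"
    proof -
      have "k * Q u / (\<mu> - \<omega>) * (\<mu> - \<omega>) = k * u powr (1 - 2 * H) * (u * K u)"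
        using \<open>\<omega> \<noteq> \<mu>\<close> by (simp add: Q_def uu)
      moreover have "k * ((\<mu> - \<omega>) * u powr (1 - 2 * H) * L u) / (\<mu> - \<omega>) = k * u powr (1 - 2 * H) * L u"
        using \<open>\<omega> \<noteq> \<mu>\<close> by simp
      ultimately show ?thesis
        by (simp only: of_real_mult) (simp add: algebra_simps)
    qed
    also have "\<dots> = V_density H u *\<^sub>R (cnj (phi H (u * (2 * \<omega>))) * phi H (u * (2 * \<mu>)))"
      using u unfolding cnj_phi_mult_phi
      by (simp add: V_density_def k_def e_def L_def K_def A_def C_def scaleR_conv_of_real mult_ac)
    finally show "(P has_vector_derivative
        V_density H u *\<^sub>R (cnj (phi H (u * (2 * \<omega>))) * phi H (u * (2 * \<mu>)))) (at u)" .
  qed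
  \<comment> \<open>\<open>P 0\<close> vanishes because of the factor
    \<open>0 powr (2 - 2 * H)\<close>.\<close>
  then show ?thesis
    by (simp add: P_def Q_def K_def e_def k_def A_def C_def mult_ac)
qed

text \<open>The weight \<open>2 * H - 1 = 1 - n\<close> of the mixed term is what yields
  \<open>u * K' = L - n * K\<close>: \<open>u * L'\<close> is
  \<open>2 * (1 - n) * (\<omega> * u * C)\<^sup>2\<close>, while \<open>u * (A * C)'\<close> is
  \<open>A\<^sup>2 - (\<omega> * u * C)\<^sup>2 - n * A * C\<close>. Hence u^n K has derivative
  u^(n-1) L.\<close>

lemma S_diagonal:
  assumes "0 \<le> T"
  shows "S H T (2 * \<omega>) (2 * \<omega>)
    = of_real (d_sq H * (2 - 2 * H) * (Gamma (1 - H))\<^sup>2 * T powr (2 - 2 * H)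
        * ((half_pow_even H (\<omega> * T))\<^sup>2 + (\<omega> * T * half_pow_odd_quot H (\<omega> * T))\<^sup>2
           + (2 * H - 1) * half_pow_even H (\<omega> * T) * half_pow_odd_quot H (\<omega> * T)))"
proof -
  define k where "k = d_sq H * (2 - 2 * H) * (Gamma (1 - H))\<^sup>2"
  define A where "A = (\<lambda>u. half_pow_even H (\<omega> * u))"
  define C where "C = (\<lambda>u. half_pow_odd_quot H (\<omega> * u))"
  define K where "K = (\<lambda>u. (A u)\<^sup>2 + (\<omega> * u * C u)\<^sup>2 + (2 * H - 1) * A u * C u)"
  define L where "L = (\<lambda>u. (A u)\<^sup>2 + (\<omega> * u * C u)\<^sup>2)"
  define Q where "Q = (\<lambda>u. k * (u powr (2 - 2 * H) * K u))"
  have dK: "(K has_real_derivative (L u - (2 - 2 * H) * K u) / u) (at u)" if "u > 0" for u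
    unfolding K_def L_def A_def C_def
    by (rule has_real_derivative_half_pow_even[OF H]
          has_real_derivative_half_pow_odd_quot[OF H less_imp_neq[OF that, symmetric]]
          derivative_eq_intros refl)+
       (use that in \<open>simp add: field_simps power2_eq_square\<close>)
  have dQ: "(Q has_real_derivative k * (u powr (1 - 2 * H) * L u)) (at u)" if "u > 0" for u
  proof -
    have "(Q has_real_derivative k * ((2 - 2 * H) * u powr (1 - 2 * H) * K u
        + (L u - (2 - 2 * H) * K u) / u * u powr (2 - 2 * H))) (at u)"
      unfolding Q_def using that by (auto intro!: derivative_eq_intros dK)
    moreover have "M / u * u powr (2 - 2 * H) = M * u powr (1 - 2 * H)" for M
      using that by (simp add: powr_diff power2_eq_square)
    ultimately show ?thesis
      by (simp only:) (simp add: algebra_simps)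
  qed
  have "S H T (2 * \<omega>) (2 * \<omega>) = of_real (Q T) - of_real (Q 0)"
  proof (rule S_eq_primitive[OF \<open>0 \<le> T\<close>])
    show "continuous_on {0..T} (\<lambda>u. complex_of_real (Q u))"
      unfolding Q_def K_def A_def C_def using H
      by (intro continuous_intros continuous_on_half_pow continuous_on_powr') auto
    fix u assume "u \<in> {0<..<T}"
    then have u: "u > 0"
      by simp
    \<comment> \<open>At equal frequencies the exponential is 1 and the imaginary part
      cancels.\<close>
    have "V_density H u *\<^sub>R (cnj (phi H (u * (2 * \<omega>))) * phi H (u * (2 * \<omega>)))
        = of_real (k * (u powr (1 - 2 * H) * L u))"
      using u unfolding cnj_phi_mult_phi
      by (simp add: V_density_def k_def L_def A_def C_def scaleR_conv_of_real power2_eq_square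
          algebra_simps)
    then show "((\<lambda>u. of_real (Q u)) has_vector_derivative
        V_density H u *\<^sub>R (cnj (phi H (u * (2 * \<omega>))) * phi H (u * (2 * \<omega>)))) (at u)"
      using dQ[OF u] by (simp only: has_vector_derivative_of_real
          has_real_derivative_iff_has_vector_derivative)
  qed
  then show ?thesis
    by (simp add: Q_def K_def k_def A_def C_def)
qed

lemma S_0_0:
  assumes "0 \<le> T"
  shows "S H T 0 0 = of_real (d_sq H * T powr (2 - 2 * H))"
proof -
  define A where "A = half_pow_even H 0"
  have C: "half_pow_odd_quot H 0 = A / (2 - 2 * H)"
    using half_pow_odd_quot_0[OF H] H by (simp add: A_def field_simps)
  have "Gamma (1 - H) \<noteq> 0"
    using H Gamma_real_pos[of "1 - H"] by linarith
  then have "(Gamma (1 - H))\<^sup>2 * A\<^sup>2 = 1"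
    by (simp add: A_def half_pow_even_0[OF H] power_divide)
  \<comment> \<open>The constants collapse because \<open>n + (2 * H - 1) = 1\<close>.\<close>
  have "(2 - 2 * H) * (A\<^sup>2 + (2 * H - 1) * A * (A / (2 - 2 * H))) = A\<^sup>2"
    using H by (simp add: field_simps power2_eq_square)
  then have "(Gamma (1 - H))\<^sup>2 * ((2 - 2 * H) * (A\<^sup>2 + (2 * H - 1) * A * half_pow_odd_quot H 0)) = 1"
    using \<open>(Gamma (1 - H))\<^sup>2 * A\<^sup>2 = 1\<close> by (simp only: C)
  moreover have "S H T 0 0 = of_real (d_sq H * T powr (2 - 2 * H)
      * ((Gamma (1 - H))\<^sup>2 * ((2 - 2 * H) * (A\<^sup>2 + (2 * H - 1) * A * half_pow_odd_quot H 0))))"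
    using S_diagonal[OF assms, of 0]
    by (simp only: A_def mult_zero_left mult_zero_right zero_power2 add_0_right mult_ac)
  ultimately show ?thesis
    by simp
qed

end

section \<open>Normalisation by \<open>S H T 0 0\<close> and the diagonal limit\<close>

theorem corollary6p2:
  fixes H T :: real
  assumes "0 < H" and "H < 1" and "0 < T"
  shows
    "(\<forall>\<omega> \<mu> :: real. \<omega> \<noteq> \<mu> \<longrightarrow>
        S H T (2 * \<omega>) (2 * \<mu>) / S H T 0 0 =
          of_real ((2 - 2 * H) * (Gamma (1 - H))\<^sup>2) * exp (\<i> * of_real (T * (\<mu> - \<omega>)))
          * (half_pow_J H 0 (of_real (T * \<omega>)) * half_pow_J H 1 (of_real (T * \<mu>))
             - half_pow_J H 1 (of_real (T * \<omega>)) * half_pow_J H 0 (of_real (T * \<mu>)))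
          / of_real (T * (\<mu> - \<omega>)))
     \<and>
     (let R = (\<lambda>\<omega> :: real.
          of_real ((2 - 2 * H) * (Gamma (1 - H))\<^sup>2)
          * ((half_pow_J H 1 (of_real (T * \<omega>)))\<^sup>2
             + of_real ((2 * H - 1) / (T * \<omega>))
               * (half_pow_J H 0 (of_real (T * \<omega>)) * half_pow_J H 1 (of_real (T * \<omega>)))
             + (half_pow_J H 0 (of_real (T * \<omega>)))\<^sup>2))
      in (\<forall>\<omega>. \<omega> \<noteq> 0 \<longrightarrow> S H T (2 * \<omega>) (2 * \<omega>) / S H T 0 0 = R \<omega>)
         \<and> (R \<longlongrightarrow> S H T (2 * 0) (2 * 0) / S H T 0 0) (at 0))"
proof -
  note H = \<open>0 < H\<close> \<open>H < 1\<close>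
  define A where "A = half_pow_even H"
  define C where "C = half_pow_odd_quot H"
  define N where "N = d_sq H * T powr (2 - 2 * H)"
  define k where "k = (2 - 2 * H) * (Gamma (1 - H))\<^sup>2"
  \<comment> \<open>The right-hand side of (ii) with the quotient by \<open>T * \<omega>\<close>
    absorbed into \<open>C\<close>; this form is meaningful and continuous at 0.\<close>
  define D where "D = (\<lambda>\<omega>. k * ((A (\<omega> * T))\<^sup>2 + (\<omega> * T * C (\<omega> * T))\<^sup>2 + (2 * H - 1) * A (\<omega> * T) * C (\<omega> * T)))"
  have N: "N > 0"
    using d_sq_pos[OF H] \<open>0 < T\<close> by (simp add: N_def)
  have S00: "S H T 0 0 = of_real N"
    using S_0_0[OF H] \<open>0 < T\<close> by (simp add: N_def)
  have J: "half_pow_J H 0 (of_real (T * x)) = of_real (A (x * T))"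
    "half_pow_J H 1 (of_real (T * x)) = of_real (x * T * C (x * T))" for x
    unfolding half_pow_J_0[OF H] half_pow_J_1[OF H] A_def C_def by (simp_all only: mult.commute)
  have diag: "S H T (2 * \<omega>) (2 * \<omega>) / S H T 0 0 = of_real (D \<omega>)" for \<omega>
  proof -
    have "S H T (2 * \<omega>) (2 * \<omega>) = of_real (N * D \<omega>)"
      using S_diagonal[OF H, of T \<omega>] \<open>0 < T\<close> by (simp only: N_def D_def k_def A_def C_def less_imp_le mult_ac)
    then show ?thesis
      using N by (simp add: S00)
  qed
  define R where "R = (\<lambda>\<omega> :: real.
      complex_of_real k
      * ((half_pow_J H 1 (of_real (T * \<omega>)))\<^sup>2
         + of_real ((2 * H - 1) / (T * \<omega>))
           * (half_pow_J H 0 (of_real (T * \<omega>)) * half_pow_J H 1 (of_real (T * \<omega>)))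
         + (half_pow_J H 0 (of_real (T * \<omega>)))\<^sup>2))"
  have R: "R \<omega> = of_real (D \<omega>)" if "\<omega> \<noteq> 0" for \<omega>
  proof -
    have "R \<omega> = of_real (k * ((\<omega> * T * C (\<omega> * T))\<^sup>2
        + (2 * H - 1) / (T * \<omega>) * (A (\<omega> * T) * (\<omega> * T * C (\<omega> * T))) + (A (\<omega> * T))\<^sup>2))"
      unfolding R_def J by (simp only: of_real_mult of_real_add of_real_power)
    also have "(2 * H - 1) / (T * \<omega>) * (A (\<omega> * T) * (\<omega> * T * C (\<omega> * T)))
        = (2 * H - 1) * A (\<omega> * T) * C (\<omega> * T)"
      using that \<open>0 < T\<close> by simp
    also have "of_real (k * ((\<omega> * T * C (\<omega> * T))\<^sup>2 + (2 * H - 1) * A (\<omega> * T) * C (\<omega> * T) + (A (\<omega> * T))\<^sup>2))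
        = of_real (D \<omega>)"
      by (simp only: D_def add_ac)
    finally show ?thesis .
  qed
  have "continuous_on UNIV (\<lambda>\<omega>. half_pow_even H (T * \<omega>))"
    "continuous_on UNIV (\<lambda>\<omega>. half_pow_odd_quot H (T * \<omega>))"
    by (intro continuous_on_half_pow[OF H])+
  then have "continuous_on UNIV (\<lambda>\<omega>. complex_of_real (D \<omega>))"
    unfolding D_def A_def C_def mult.commute[of _ T] by (intro continuous_intros)
  then have "((\<lambda>\<omega>. complex_of_real (D \<omega>)) \<longlongrightarrow> of_real (D 0)) (at 0)"
    unfolding continuous_on_def by (rule bspec) simp
  \<comment> \<open>\<open>R\<close> and \<open>D\<close> agree at every nonzero argument, so they
    share the limit \<open>D 0\<close>, which \<open>diag\<close> identifies with the ratio at
    frequency 0.\<close>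
  then have lim: "(R \<longlongrightarrow> S H T (2 * 0) (2 * 0) / S H T 0 0) (at 0)"
    unfolding diag by (rule Lim_transform_eventually) (auto simp: eventually_at_filter R)
  have off: "S H T (2 * \<omega>) (2 * \<mu>) / S H T 0 0 =
      of_real k * exp (\<i> * of_real (T * (\<mu> - \<omega>)))
      * (half_pow_J H 0 (of_real (T * \<omega>)) * half_pow_J H 1 (of_real (T * \<mu>))
         - half_pow_J H 1 (of_real (T * \<omega>)) * half_pow_J H 0 (of_real (T * \<mu>)))
      / of_real (T * (\<mu> - \<omega>))" if "\<omega> \<noteq> \<mu>" for \<omega> \<mu>
  proof -
    define K where "K = \<mu> * A (\<omega> * T) * C (\<mu> * T) - \<omega> * C (\<omega> * T) * A (\<mu> * T)"
    have "S H T (2 * \<omega>) (2 * \<mu>) = of_real (N * (k * K / (\<mu> - \<omega>))) * exp (\<i> * of_real (T * (\<mu> - \<omega>)))"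
      using S_off_diagonal[OF H, of T \<omega> \<mu>] \<open>0 < T\<close> that
      by (simp add: N_def K_def k_def A_def C_def mult_ac)
    then have "S H T (2 * \<omega>) (2 * \<mu>) / S H T 0 0 = of_real (k * K / (\<mu> - \<omega>)) * exp (\<i> * of_real (T * (\<mu> - \<omega>)))"
      using N by (simp add: S00)
    \<comment> \<open>Expanding the fraction by \<open>T\<close> completes
      \<open>\<mu> * C (\<mu> * T)\<close> to the value \<open>\<mu> * T * C (\<mu> * T)\<close> of
      \<open>half_pow_J H 1\<close>, and likewise for \<open>\<omega>\<close>.\<close>
    also have "k * K / (\<mu> - \<omega>) = k * (T * K) / (T * (\<mu> - \<omega>))"
      using \<open>0 < T\<close> by simp
    also have "T * K = A (\<omega> * T) * (\<mu> * T * C (\<mu> * T)) - \<omega> * T * C (\<omega> * T) * A (\<mu> * T)"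
      by (simp add: K_def algebra_simps)
    finally show ?thesis
      unfolding J by (simp only: of_real_mult of_real_diff of_real_divide) (simp add: field_simps)
  qed
  show ?thesis
    unfolding Let_def R_def[unfolded k_def, symmetric] using off lim diag R by (simp add: k_def)
qed

end
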